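(* For any directed graph $G=(V,E)$ on $n$ vertices with positive real edge capacities $w$, a designated source vertex $s$ and a designated sink vertex $t$, there is a data structure occupying $\mathcal{O}(n)$ space that, given any edge $e\in E$ together with its capacity $w(e)$, reports the vitality of $e$ in $\mathcal{O}(1)$ time.
   Context: An $(s,t)$-cut is a set $C\subset V$ with $s\in C$, $t\notin C$; its capacity is the sum of capacities of edges from $C$ to $V\setminus C$; the $(s,t)$-mincut capacity is the minimum capacity of an $(s,t)$-cut. The vitality of an edge $e$ is the reduction in the $(s,t)$-mincut capacity caused by removing $e$ from $G$ (so it is $0$ for a non-vital edge). Space is measured in machine words. *)

theory Defs
  imports "HOL-Analysis.Analysis" "Graph_Theory.Digraph"
begin

definition st_cut :: "('v, 'e) pre_digraph \<Rightarrow> 'v \<Rightarrow> 'v \<Rightarrow> 'v set \<Rightarrow> bool" where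
  "st_cut G s t C \<longleftrightarrow> C \<subseteq> verts G \<and> s \<in> C \<and> t \<notin> C"

definition cut_capacity :: "('v, 'e) pre_digraph \<Rightarrow> ('e \<Rightarrow> real) \<Rightarrow> 'v set \<Rightarrow> real" where
  "cut_capacity G w C = (\<Sum>e | e \<in> arcs G \<and> tail G e \<in> C \<and> head G e \<in> verts G - C. w e)"

definition mincut_capacity ::
    "('v, 'e) pre_digraph \<Rightarrow> ('e \<Rightarrow> real) \<Rightarrow> 'v \<Rightarrow> 'v \<Rightarrow> real" where
  "mincut_capacity G w s t = Min (cut_capacity G w ` {C. st_cut G s t C})"

definition vitality ::
    "('v, 'e) pre_digraph \<Rightarrow> ('e \<Rightarrow> real) \<Rightarrow> 'v \<Rightarrow> 'v \<Rightarrow> 'e \<Rightarrow> real" where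
  "vitality G w s t e =
     mincut_capacity G w s t - mincut_capacity (pre_digraph.del_arc G e) w s t"


text \<open>
  The machine is a word RAM with \<open>b\<close>-bit integer words, extended with words that hold a real
  number. A data structure is a pair of read-only memories, a list of integer words and a list of
  real words. A query is answered by a program working on integer and real registers; a program is
  a finite instruction list, so it touches only finitely many registers. Integer arithmetic wraps
  around modulo \<open>2 ^ b\<close>. Real words can only be loaded, added, subtracted and compared; in
  particular there is no conversion from real to integer words, which would allow unboundedly much
  information to be decoded from a single real word.
\<close>

datatype word_op = Plus | Minus | Times | Div | Mod | And | Or | Xor | Shl | Shr

fun word_op_sem :: "nat \<Rightarrow> word_op \<Rightarrow> nat \<Rightarrow> nat \<Rightarrow> nat" where
  "word_op_sem b Plus x y = take_bit b (x + y)"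
| "word_op_sem b Minus x y = take_bit b (x + 2 ^ b - y)"
| "word_op_sem b Times x y = take_bit b (x * y)"
| "word_op_sem b Div x y = take_bit b (x div y)"
| "word_op_sem b Mod x y = take_bit b (x mod y)"
| "word_op_sem b And x y = take_bit b (Bit_Operations.and x y)"
| "word_op_sem b Or x y = take_bit b (Bit_Operations.or x y)"
| "word_op_sem b Xor x y = take_bit b (Bit_Operations.xor x y)"
| "word_op_sem b Shl x y = take_bit b (push_bit y x)"
| "word_op_sem b Shr x y = take_bit b (drop_bit y x)"

text \<open>
  In the instructions below the first register is the destination, jump targets come last, and
  both kinds of load take their address from an integer register.
\<close>

datatype instr =
    WConst nat nat
  | WOp word_op nat nat nat
  | WLoad nat nat
  | RLoad nat nat
  | RAdd nat nat nat
  | RSub nat nat nat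
  | Jump nat
  | JumpIfWLess nat nat nat
  | JumpIfRLess nat nat nat

record config =
  pc :: nat
  wreg :: "nat \<Rightarrow> nat"
  rreg :: "nat \<Rightarrow> real"

definition set_wreg :: "nat \<Rightarrow> nat \<Rightarrow> config \<Rightarrow> config" where
  "set_wreg i x S = S\<lparr>wreg := (wreg S)(i := x), pc := Suc (pc S)\<rparr>"

definition set_rreg :: "nat \<Rightarrow> real \<Rightarrow> config \<Rightarrow> config" where
  "set_rreg i x S = S\<lparr>rreg := (rreg S)(i := x), pc := Suc (pc S)\<rparr>"

definition jump_if :: "bool \<Rightarrow> nat \<Rightarrow> config \<Rightarrow> config" where
  "jump_if P l S = S\<lparr>pc := (if P then l else Suc (pc S))\<rparr>"

text \<open>The result \<open>None\<close> stands for an out-of-bounds memory access.\<close>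

fun exec_instr ::
    "nat \<Rightarrow> nat list \<Rightarrow> real list \<Rightarrow> instr \<Rightarrow> config \<Rightarrow> config option" where
  "exec_instr b W R (WConst i k) S = Some (set_wreg i (take_bit b k) S)"
| "exec_instr b W R (WOp f i j k) S =
     Some (set_wreg i (word_op_sem b f (wreg S j) (wreg S k)) S)"
| "exec_instr b W R (WLoad i j) S =
     (if wreg S j < length W then Some (set_wreg i (W ! wreg S j) S) else None)"
| "exec_instr b W R (RLoad i j) S =
     (if wreg S j < length R then Some (set_rreg i (R ! wreg S j) S) else None)"
| "exec_instr b W R (RAdd i j k) S = Some (set_rreg i (rreg S j + rreg S k) S)"
| "exec_instr b W R (RSub i j k) S = Some (set_rreg i (rreg S j - rreg S k) S)"
| "exec_instr b W R (Jump l) S = Some (jump_if True l S)"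
| "exec_instr b W R (JumpIfWLess i j l) S = Some (jump_if (wreg S i < wreg S j) l S)"
| "exec_instr b W R (JumpIfRLess i j l) S = Some (jump_if (rreg S i < rreg S j) l S)"

text \<open>
  A program halts by leaving the instruction list; its result is then in real register 0.
  \<open>run b P W R T S = Some x\<close> means that it halts without a fault after at most \<open>T\<close> steps, with
  result \<open>x\<close>.
\<close>

fun run ::
    "nat \<Rightarrow> instr list \<Rightarrow> nat list \<Rightarrow> real list \<Rightarrow> nat \<Rightarrow> config \<Rightarrow> real option" where
  "run b P W R T S =
     (if length P \<le> pc S then Some (rreg S 0)
      else case T of
             0 \<Rightarrow> None
           | Suc T' \<Rightarrow>
               (case exec_instr b W R (P ! pc S) S of
                  None \<Rightarrow> None
                | Some S' \<Rightarrow> run b P W R T' S'))"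

text \<open>
  The query for an edge passes the numbers of its tail and head in integer registers 0 and 1 and
  its capacity in real register 0.
\<close>

definition query :: "nat \<Rightarrow> nat \<Rightarrow> real \<Rightarrow> config" where
  "query u v x = \<lparr>pc = 0, wreg = (\<lambda>_. 0)(0 := u, 1 := v), rreg = (\<lambda>_. 0)(0 := x)\<rparr>"

end

theory Submission
  imports Defs "HOL-Library.Discrete_Functions"
begin

text \<open>
  Call a minimum-capacity cut among those crossed by a vital edge \<open>e\<close> a witness cut of \<open>e\<close>; its excess
  over the mincut capacity is \<open>w e\<close> minus the vitality of \<open>e\<close>. Submodularity shows that a vital edge
  never enters a witness cut of another one. Hence among the witness cuts separating the endpoints of
  a vital edge, in either direction, the cheapest one is a witness cut of that edge, and for an
  arbitrary edge \<open>(u, v)\<close> it suffices to know the cheapest witness cut separating \<open>u\<close> from \<open>v\<close>: if it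
  contains \<open>v\<close>, the vitality is zero, and otherwise it is the positive part of \<open>w (u, v)\<close> minus the
  excess. Splitting the vertex set recursively along cheapest separating cuts arranges the vertices
  in a line such that the cheapest cut between two vertices is a range minimum over the gaps between
  them, and contains the left one.

  Range minima take linear space and constant time: the line is cut into blocks of logarithmic
  length, a sparse table covers runs of whole blocks, and within a block the positions of the running
  minima from each left end fit into one machine word.
\<close>

section \<open>Vital edges and witness cuts\<close>

locale st_network = fin_digraph G for G :: "('v, 'e) pre_digraph" +
  fixes w :: "'e \<Rightarrow> real" and s t :: 'v
  assumes source: "s \<in> verts G" and source_neq_sink: "s \<noteq> t"
    and capacity_pos: "e \<in> arcs G \<Longrightarrow> 0 < w e"
begin

abbreviation "flow_value \<equiv> mincut_capacity G w s t"

definition crosses :: "'e \<Rightarrow> 'v set \<Rightarrow> bool" where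
  "crosses e C \<longleftrightarrow> tail G e \<in> C \<and> head G e \<notin> C"

lemma finite_st_cuts: "finite {C. st_cut G s t C}"
  by (rule finite_subset[of _ "Pow (verts G)"]) (auto simp: st_cut_def)

lemma st_cuts_nonempty: "{C. st_cut G s t C} \<noteq> {}"
  using source source_neq_sink by (auto simp: st_cut_def intro!: exI[of _ "{s}"])

lemma st_cut_Int: "st_cut G s t C \<Longrightarrow> st_cut G s t D \<Longrightarrow> st_cut G s t (C \<inter> D)"
  by (auto simp: st_cut_def)

lemma st_cut_Un: "st_cut G s t C \<Longrightarrow> st_cut G s t D \<Longrightarrow> st_cut G s t (C \<union> D)"
  by (auto simp: st_cut_def)

lemma cut_capacity_eq:
  "cut_capacity G w C = (\<Sum>e\<in>arcs G. if crosses e C then w e else 0)"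
proof -
  have "{e \<in> arcs G. tail G e \<in> C \<and> head G e \<in> verts G - C} = {e \<in> arcs G. crosses e C}"
    by (auto simp: crosses_def)
  then show ?thesis
    by (simp add: cut_capacity_def sum.If_cases Int_def)
qed

lemma flow_value_le: "st_cut G s t C \<Longrightarrow> flow_value \<le> cut_capacity G w C"
  unfolding mincut_capacity_def using finite_st_cuts by (intro Min_le) auto

lemma cut_capacity_del_arc:
  assumes "e \<in> arcs G"
  shows "cut_capacity (del_arc e) w C = cut_capacity G w C - (if crosses e C then w e else 0)"
proof -
  interpret del: fin_digraph "del_arc e"
    by (rule fin_digraph_del_arc)
  have "cut_capacity (del_arc e) w C = (\<Sum>x\<in>arcs G - {e}. if crosses x C then w x else 0)"
    unfolding cut_capacity_def
    by (subst sum.inter_filter[symmetric]) (auto simp: crosses_def intro!: sum.cong)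
  also have "\<dots> = cut_capacity G w C - (if crosses e C then w e else 0)"
    unfolding cut_capacity_eq using assms by (subst sum_diff1) auto
  finally show ?thesis .
qed

lemma st_cut_del_arc: "st_cut (del_arc e) s t C \<longleftrightarrow> st_cut G s t C"
  by (simp add: st_cut_def)

lemma mincut_del_arc_le:
  assumes "e \<in> arcs G" "st_cut G s t C"
  shows "mincut_capacity (del_arc e) w s t \<le> cut_capacity G w C - (if crosses e C then w e else 0)"
  unfolding mincut_capacity_def st_cut_del_arc
  using finite_st_cuts assms by (intro Min_le) (auto simp: cut_capacity_del_arc)

lemma vitality_ge:
  assumes "e \<in> arcs G" "st_cut G s t C" "crosses e C"
  shows "w e - (cut_capacity G w C - flow_value) \<le> vitality G w s t e"
  using mincut_del_arc_le[OF assms(1,2)] assms(3) by (simp add: vitality_def)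

lemma vitality_nonneg:
  assumes "e \<in> arcs G"
  shows "0 \<le> vitality G w s t e"
proof -
  obtain C where C: "st_cut G s t C" "cut_capacity G w C = flow_value"
    using Min_in[OF finite_imageI[OF finite_st_cuts], of "cut_capacity G w"] st_cuts_nonempty
    by (auto simp: mincut_capacity_def)
  show ?thesis
    using mincut_del_arc_le[OF assms C(1)] C(2) capacity_pos[OF assms]
    by (auto simp: vitality_def split: if_splits)
qed

text \<open>Minimality is encoded by a value: the excess over \<open>flow_value\<close> is exactly
  the part of \<open>w e\<close> that is not vitality. \<open>witness_cut_minimal\<close> recovers
  the comparison with other cuts.\<close>

definition witness_cut :: "'e \<Rightarrow> 'v set \<Rightarrow> bool" where
  "witness_cut e C \<longleftrightarrow> e \<in> arcs G \<and> st_cut G s t C \<and> crosses e C \<and>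
     0 < vitality G w s t e \<and> vitality G w s t e = w e - (cut_capacity G w C - flow_value)"

text \<open>A mincut of the graph without \<open>e\<close> works: if \<open>e\<close> did not cross
  it, its capacity, at least \<open>flow_value\<close>, would survive the deletion and the vitality
  could not be positive.\<close>

lemma witness_cut_exists:
  assumes "e \<in> arcs G" "0 < vitality G w s t e"
  shows "\<exists>C. witness_cut e C"
proof -
  obtain C where C: "st_cut G s t C"
    "mincut_capacity (del_arc e) w s t = cut_capacity G w C - (if crosses e C then w e else 0)"
    using Min_in[OF finite_imageI[OF finite_st_cuts], of "cut_capacity (del_arc e) w"]
      st_cuts_nonempty assms(1)
    by (auto simp: mincut_capacity_def st_cut_del_arc cut_capacity_del_arc)
  moreover have "crosses e C"
    using flow_value_le[OF C(1)] C(2) assms(2) by (auto simp: vitality_def split: if_splits)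
  ultimately show ?thesis
    using assms by (auto simp: witness_cut_def vitality_def)
qed

lemma witness_cut_minimal:
  assumes "witness_cut e C" "st_cut G s t D" "crosses e D"
  shows "cut_capacity G w C \<le> cut_capacity G w D"
  using vitality_ge[of e D] assms by (auto simp: witness_cut_def)

text \<open>Submodularity with its exact defect: an arc between the two differences crosses one of
  \<open>C\<close> and \<open>D\<close>, but neither their intersection nor their union.\<close>

lemma cut_capacity_Int_Un:
  assumes "C \<subseteq> verts G" "D \<subseteq> verts G"
  shows "cut_capacity G w (C \<inter> D) + cut_capacity G w (C \<union> D) +
      (\<Sum>e | e \<in> arcs G \<and> (tail G e \<in> C - D \<and> head G e \<in> D - C \<or> tail G e \<in> D - C \<and> head G e \<in> C - D). w e)
    = cut_capacity G w C + cut_capacity G w D"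
  unfolding cut_capacity_eq
  by (subst sum.inter_filter) (auto simp: crosses_def sum.distrib[symmetric] intro!: sum.cong)

text \<open>Both arcs of a violating pair would be lost by uncrossing the two cuts, unless
  one of the uncrossed cuts is still crossed by the first arc.\<close>

lemma vital_arc_not_entering:
  assumes e: "witness_cut e C" and f: "f \<in> arcs G" "0 < vitality G w s t f"
  shows "\<not> (tail G f \<notin> C \<and> head G f \<in> C)"
proof
  assume f_enters: "tail G f \<notin> C \<and> head G f \<in> C"
  obtain D where D: "witness_cut f D"
    using witness_cut_exists[OF f] by blast
  note eC = e[unfolded witness_cut_def] and fD = D[unfolded witness_cut_def]
  have CD: "st_cut G s t (C \<inter> D)" "st_cut G s t (C \<union> D)"
    using eC fD by (auto intro: st_cut_Int st_cut_Un)
  define X where "X = {a \<in> arcs G. tail G a \<in> C - D \<and> head G a \<in> D - C \<or>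
    tail G a \<in> D - C \<and> head G a \<in> C - D}"
  have fX: "f \<in> X"
    using f_enters fD by (auto simp: X_def crosses_def)
  have finX: "finite X" by (simp add: X_def)
  have X_ge: "sum w Y \<le> sum w X" if "Y \<subseteq> X" for Y
    using capacity_pos that by (intro sum_mono2 finX) (auto simp: X_def less_imp_le)
  have eq: "cut_capacity G w (C \<inter> D) + cut_capacity G w (C \<union> D) + sum w X
      = cut_capacity G w C + cut_capacity G w D"
    unfolding X_def using eC fD by (intro cut_capacity_Int_Un) (auto simp: st_cut_def)
  \<comment> \<open>An arc leaving \<open>C\<close> crosses the intersection if its tail is in
    \<open>D\<close>; otherwise it crosses the union, unless its head is in
    \<open>D\<close>.\<close>
  consider "crosses e (C \<inter> D)" | "crosses e (C \<union> D)" | "e \<in> X"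
    using eC f_enters by (auto simp: crosses_def X_def)
  then show False
  proof cases
    \<comment> \<open>The intersection costs at least as much as \<open>C\<close> and the union at
      least \<open>flow_value\<close>, so \<open>w f\<close> is at most the excess of
      \<open>D\<close>, which is \<open>w f\<close> minus a positive vitality.\<close>
    case 1
    then show False
      using witness_cut_minimal[OF e CD(1)] flow_value_le[OF CD(2)] X_ge[of "{f}"] fX eq fD by simp
  next
    case 2
    then show False
      using witness_cut_minimal[OF e CD(2)] flow_value_le[OF CD(1)] X_ge[of "{f}"] fX eq fD by simp
  next
    \<comment> \<open>Now the defect contains both arcs, so \<open>w e + w f\<close> is at most the
      sum of both excesses, which is smaller by both vitalities.\<close>
    case 3
    moreover have "e \<noteq> f"
      using eC f_enters by (auto simp: crosses_def)
    ultimately show False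
      using flow_value_le[OF CD(1)] flow_value_le[OF CD(2)] X_ge[of "{e, f}"] fX eq eC fD by simp
  qed
qed

end

section \<open>Linear arrangement along cheapest separating sets\<close>

text \<open>\<open>C\<close> competes with sets separating the pair in either direction but contains
  \<open>u\<close> itself; this orientation later decides whether an arc can be vital.\<close>

definition optimal_separator :: "'a set \<Rightarrow> ('a set \<Rightarrow> real) \<Rightarrow> 'a \<Rightarrow> 'a \<Rightarrow> 'a set \<Rightarrow> bool" where
  "optimal_separator V d u v C \<longleftrightarrow> C \<subseteq> V \<and> u \<in> C \<and> v \<notin> C \<and>
     (\<forall>D\<subseteq>V. (u \<in> D) \<noteq> (v \<in> D) \<longrightarrow> d C \<le> d D)"

text \<open>Splitting \<open>S\<close> along a cheapest separating set and recursing yields a binary tree; \<open>xs\<close> lists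
  its leaves, and the value between two neighbouring leaves is the cost at their lowest common
  ancestor.\<close>

lemma exists_separator_ordering:
  fixes d :: "'a set \<Rightarrow> real"
  assumes "finite V" "S \<subseteq> V" "S \<noteq> {}"
  shows "\<exists>xs as. distinct xs \<and> set xs = S \<and> length xs = Suc (length as) \<and>
    (\<forall>i j. i < j \<and> j < length xs \<longrightarrow>
      (\<exists>C. optimal_separator V d (xs ! i) (xs ! j) C \<and> d C = Min ((!) as ` {i..<j})))"
proof -
  have "finite S"
    using assms finite_subset by blast
  then show ?thesis
    using assms(2,3)
  proof (induction S rule: finite_psubset_induct)
    case (psubset S)
    show ?case
    proof (cases "\<exists>u\<in>S. \<exists>v\<in>S. u \<noteq> v")
      case False
      then obtain v where "S = {v}"
        using psubset.prems by blast
      then show ?thesis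
        by (intro exI[of _ "[v]"] exI[of _ "[]"]) auto
    next
      case True
      \<comment> \<open>The sets that split \<open>S\<close>; a cheapest one is optimal for every
        pair from \<open>S\<close> that it separates.\<close>
      define F where "F = {C \<in> Pow V. S \<inter> C \<noteq> {} \<and> S - C \<noteq> {}}"
      have "finite F"
        using \<open>finite V\<close> by (simp add: F_def)
      moreover have "F \<noteq> {}"
      proof -
        obtain u v where "u \<in> S" "v \<in> S" "u \<noteq> v" using True by blast
        then have "{u} \<in> F" using psubset.prems by (auto simp: F_def)
        then show ?thesis by blast
      qed
      ultimately obtain C where C: "C \<in> F" "\<And>D. D \<in> F \<Longrightarrow> d C \<le> d D"
        using arg_min_if_finite(1)[of F d] arg_min_least[of F _ d] by blast
      have parts: "S \<inter> C \<subset> S" "S - C \<subset> S" "S \<inter> C \<subseteq> V" "S - C \<subseteq> V"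
          "S \<inter> C \<noteq> {}" "S - C \<noteq> {}" and "C \<subseteq> V"
        using C(1) psubset.prems(1) by (auto simp: F_def)
      obtain xs as where
        xs: "distinct xs" "set xs = S \<inter> C" "length xs = Suc (length as)" and
        as: "\<And>i j. i < j \<Longrightarrow> j < length xs \<Longrightarrow>
          \<exists>D. optimal_separator V d (xs ! i) (xs ! j) D \<and> d D = Min ((!) as ` {i..<j})"
        using psubset.IH[OF parts(1,3,5)] by blast
      obtain ys bs where
        ys: "distinct ys" "set ys = S - C" "length ys = Suc (length bs)" and
        bs: "\<And>i j. i < j \<Longrightarrow> j < length ys \<Longrightarrow>
          \<exists>D. optimal_separator V d (ys ! i) (ys ! j) D \<and> d D = Min ((!) bs ` {i..<j})"
        using psubset.IH[OF parts(2,4,6)] by blast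
      \<comment> \<open>The part inside \<open>C\<close> comes first, so \<open>C\<close> contains
        the left vertex of every pair straddling the new gap, whose value is
        \<open>d C\<close>.\<close>
      define zs cs where "zs = xs @ ys" and "cs = as @ d C # bs"
      have sep_ge: "d C \<le> d D" if "u \<in> S" "v \<in> S" "D \<subseteq> V" "(u \<in> D) \<noteq> (v \<in> D)" for u v D
        using that by (intro C(2)) (auto simp: F_def)
      \<comment> \<open>A gap value inside a part is the cost of a set separating two neighbours
        from \<open>S\<close>. That set splits \<open>S\<close> too, so it is no cheaper than
        \<open>C\<close>.\<close>
      have as_ge: "d C \<le> as ! i" if "i < length as" for i
      proof -
        obtain D where D: "optimal_separator V d (xs ! i) (xs ! Suc i) D" "d D = as ! i"
          using as[of i "Suc i"] xs(3) \<open>i < length as\<close> by auto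
        have "xs ! i \<in> S" "xs ! Suc i \<in> S"
          using nth_mem[of i xs] nth_mem[of "Suc i" xs] xs(2,3) that by auto
        then show ?thesis
          using sep_ge[of "xs ! i" "xs ! Suc i" D] D by (simp add: optimal_separator_def)
      qed
      have bs_ge: "d C \<le> bs ! i" if "i < length bs" for i
      proof -
        obtain D where D: "optimal_separator V d (ys ! i) (ys ! Suc i) D" "d D = bs ! i"
          using bs[of i "Suc i"] ys(3) \<open>i < length bs\<close> by auto
        have "ys ! i \<in> S" "ys ! Suc i \<in> S"
          using nth_mem[of i ys] nth_mem[of "Suc i" ys] ys(2,3) that by auto
        then show ?thesis
          using sep_ge[of "ys ! i" "ys ! Suc i" D] D by (simp add: optimal_separator_def)
      qed
      have cs_ge: "d C \<le> cs ! i" if "i < length cs" for i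
        using that as_ge bs_ge[of "i - Suc (length as)"]
        by (auto simp: cs_def nth_append nth_Cons' not_less)
      have "\<exists>D. optimal_separator V d (zs ! i) (zs ! j) D \<and> d D = Min ((!) cs ` {i..<j})"
        if ij: "i < j" "j < length zs" for i j
      proof -
        consider "j < length xs" | "length xs \<le> i" | "i < length xs" "length xs \<le> j"
          by linarith
        then show ?thesis
        proof cases
          case 1
          moreover have "(!) cs ` {i..<j} = (!) as ` {i..<j}"
            using 1 xs(3) by (intro image_cong) (auto simp: cs_def nth_append)
          ultimately show ?thesis
            using as[of i j] ij by (simp add: zs_def nth_append)
        next
          case 2
          let ?k = "length xs"
          have "(!) cs ` {i..<j} = (!) cs ` (+) ?k ` {i - ?k..<j - ?k}"
            using 2 ij by simp
          also have "\<dots> = (!) bs ` {i - ?k..<j - ?k}"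
            unfolding image_image
            using xs(3) by (intro image_cong) (auto simp: cs_def nth_append)
          finally show ?thesis
            using bs[of "i - ?k" "j - ?k"] 2 ij by (simp add: zs_def nth_append)
        next
          case 3
          have u: "zs ! i \<in> S \<inter> C"
            using 3 xs(2) nth_mem[of i xs] by (simp add: zs_def nth_append)
          have "j - length xs < length ys"
            using ij 3 by (simp add: zs_def)
          then have v: "zs ! j \<in> S - C"
            using 3 ys(2) nth_mem[of "j - length xs" ys] by (simp add: zs_def nth_append)
          have "optimal_separator V d (zs ! i) (zs ! j) C"
            using u v sep_ge[of "zs ! i" "zs ! j"] \<open>C \<subseteq> V\<close> by (auto simp: optimal_separator_def)
          moreover have "d C = Min ((!) cs ` {i..<j})"
          proof (rule Min_eqI[symmetric])
            show "d C \<in> (!) cs ` {i..<j}"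
              using 3 xs(3) by (intro image_eqI[of _ _ "length as"]) (auto simp: cs_def)
            show "d C \<le> x" if "x \<in> (!) cs ` {i..<j}" for x
              using that ij cs_ge xs(3) ys(3) by (auto simp: zs_def cs_def)
          qed simp
          ultimately show ?thesis by blast
        qed
      qed
      moreover have "distinct zs" "set zs = S" "length zs = Suc (length cs)"
        using xs ys by (auto simp: zs_def cs_def)
      ultimately show ?thesis by blast
    qed
  qed
qed

section \<open>Vitality as a range minimum\<close>

context st_network
begin

text \<open>Sets that are witness cuts of no arc get the total capacity as default. No single arc
  exceeds it, so such a set never yields a positive vitality.\<close>

definition separator_cost :: "'v set \<Rightarrow> real" where
  "separator_cost C = (if \<exists>e. witness_cut e C then cut_capacity G w C - flow_value else sum w (arcs G))"

text \<open>For vital \<open>e\<close>, its witness cuts cost less than the default, so the optimum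
  \<open>C\<close> is a witness cut too, possibly of another arc. Hence \<open>C\<close> is an
  st-cut crossed by \<open>e\<close>, and minimality forces equal costs. For non-vital
  \<open>e\<close>, every st-cut it crosses has excess at least \<open>w e\<close>.\<close>

lemma vitality_eq_separator_cost:
  assumes e: "e \<in> arcs G" and C: "optimal_separator (verts G) separator_cost (tail G e) (head G e) C"
  shows "vitality G w s t e = max 0 (w e - separator_cost C)"
proof -
  have w_le: "w e \<le> sum w (arcs G)"
    using e capacity_pos by (intro member_le_sum) (auto simp: less_imp_le)
  have crosses: "crosses e C" and opt: "D \<subseteq> verts G \<Longrightarrow> crosses e D \<Longrightarrow> separator_cost C \<le> separator_cost D" for D
    using C by (auto simp: optimal_separator_def crosses_def)
  show ?thesis
  proof (cases "0 < vitality G w s t e")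
    case True
    then obtain D where D: "witness_cut e D"
      using witness_cut_exists e by blast
    then have D': "separator_cost D = cut_capacity G w D - flow_value" "crosses e D" "D \<subseteq> verts G"
      "vitality G w s t e = w e - separator_cost D"
      by (auto simp: separator_cost_def witness_cut_def st_cut_def)
    then have "separator_cost C < sum w (arcs G)"
      using opt[of D] True w_le by linarith
    then have "\<exists>f. witness_cut f C"
      by (metis separator_cost_def less_irrefl)
    then have "st_cut G s t C" "separator_cost C = cut_capacity G w C - flow_value"
      unfolding separator_cost_def by (auto simp: witness_cut_def)
    then show ?thesis
      using witness_cut_minimal[OF D, of C] crosses D' opt[of D] True by simp
  next
    case False
    then have "vitality G w s t e = 0"
      using vitality_nonneg[OF e] by simp
    moreover have "w e \<le> separator_cost C"
      using vitality_ge[OF e _ crosses] w_le False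
      by (auto simp: separator_cost_def witness_cut_def intro: order_trans)
    ultimately show ?thesis by simp
  qed
qed

text \<open>If \<open>e\<close> were vital, the optimum would again cost less than the default and
  be a witness cut of some arc, entered by \<open>e\<close>; \<open>vital_arc_not_entering\<close>
  excludes this.\<close>

lemma vitality_eq_0_of_entering_separator:
  assumes e: "e \<in> arcs G" and C: "optimal_separator (verts G) separator_cost (head G e) (tail G e) C"
  shows "vitality G w s t e = 0"
proof (rule ccontr)
  assume "vitality G w s t e \<noteq> 0"
  then have vital: "0 < vitality G w s t e"
    using vitality_nonneg[OF e] by simp
  then obtain D where D: "witness_cut e D"
    using witness_cut_exists e by blast
  have "separator_cost C \<le> separator_cost D"
    using C D by (auto simp: optimal_separator_def witness_cut_def st_cut_def crosses_def)
  also have "\<dots> = w e - vitality G w s t e"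
    using D by (auto simp: separator_cost_def witness_cut_def)
  also have "\<dots> < sum w (arcs G)"
    using vital member_le_sum[of e "arcs G" w] e capacity_pos by (force simp: less_imp_le)
  finally obtain f where "witness_cut f C"
    by (auto simp: separator_cost_def split: if_splits)
  then show False
    using vital_arc_not_entering[OF _ e vital] C by (auto simp: optimal_separator_def)
qed

lemma vitality_loop:
  assumes "e \<in> arcs G" "tail G e = head G e"
  shows "vitality G w s t e = 0"
proof (rule ccontr)
  assume "vitality G w s t e \<noteq> 0"
  then obtain C where "witness_cut e C"
    using witness_cut_exists[OF assms(1)] vitality_nonneg[OF assms(1)] by fastforce
  then show False
    using assms(2) by (simp add: witness_cut_def crosses_def)
qed

text \<open>\<open>p\<close> is the position in the arrangement and \<open>a\<close> lists the gap
  costs. For an arc running backwards the cheapest separator contains its head, and equal positions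
  mean a loop; both give zero.\<close>

lemma exists_vitality_tables:
  "\<exists>p a. p ` verts G \<subseteq> {..<card (verts G)} \<and> (\<forall>e\<in>arcs G. vitality G w s t e =
    (if p (tail G e) < (p (head G e) :: nat) then max 0 (w e - Min (a ` {p (tail G e)..<p (head G e)})) else 0))"
proof -
  obtain xs as where xs: "distinct xs" "set xs = verts G" and
    sep: "\<And>i j. i < j \<Longrightarrow> j < length xs \<Longrightarrow>
      \<exists>C. optimal_separator (verts G) separator_cost (xs ! i) (xs ! j) C \<and>
        separator_cost C = Min ((!) as ` {i..<j})"
    using exists_separator_ordering[OF finite_verts order_refl, of separator_cost] source by blast
  have "\<forall>v\<in>verts G. \<exists>i<length xs. xs ! i = v"
    using xs(2) by (metis in_set_conv_nth)
  then obtain p where p: "\<And>v. v \<in> verts G \<Longrightarrow> p v < length xs \<and> xs ! p v = v"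
    by metis
  have "vitality G w s t e =
      (if p (tail G e) < p (head G e) then max 0 (w e - Min ((!) as ` {p (tail G e)..<p (head G e)})) else 0)"
    if e: "e \<in> arcs G" for e
  proof -
    have ends: "p (tail G e) < length xs" "xs ! p (tail G e) = tail G e"
      "p (head G e) < length xs" "xs ! p (head G e) = head G e"
      using p e by auto
    consider "p (tail G e) < p (head G e)" | "p (head G e) < p (tail G e)" | "p (tail G e) = p (head G e)"
      by linarith
    then show ?thesis
    proof cases
      case 1
      then show ?thesis
        using sep[OF 1] ends vitality_eq_separator_cost[OF e] by auto
    next
      case 2
      then show ?thesis
        using sep[OF 2] ends vitality_eq_0_of_entering_separator[OF e] by auto
    next
      case 3
      then have "tail G e = head G e"
        using ends by metis
      then show ?thesis
        using vitality_loop[OF e] by simp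
    qed
  qed
  moreover have "length xs = card (verts G)"
    using xs distinct_card by metis
  ultimately show ?thesis
    using p by (intro exI[of _ p] exI[of _ "(!) as"]) auto
qed

end

section \<open>Range minima\<close>

lemma Min_image_Un:
  fixes f :: "'a \<Rightarrow> 'b::linorder"
  assumes "finite A" "A \<noteq> {}" "finite B" "B \<noteq> {}"
  shows "Min (f ` (A \<union> B)) = min (Min (f ` A)) (Min (f ` B))"
  using assms by (simp add: image_Un Min_Un)

lemma bit_floor_log:
  assumes "0 < (x::nat)"
  shows "bit x (floor_log x)"
proof -
  have "x div 2 ^ floor_log x = 1"
    using assms floor_log_exp2_le[of x] floor_log_exp2_gt[of x]
    by (intro div_nat_eqI) auto
  then show ?thesis
    by (simp add: bit_iff_odd)
qed

lemma bit_imp_le_floor_log: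
  assumes "bit (x::nat) k"
  shows "k \<le> floor_log x"
proof -
  have "x div 2 ^ k \<noteq> 0"
    using assms by (metis bit_iff_odd dvd_0_right)
  then have "2 ^ k \<le> x"
    by (simp add: div_eq_0_iff)
  then have "floor_log (2 ^ k) \<le> floor_log x"
    by (rule floor_log_le_iff)
  then show ?thesis by simp
qed

text \<open>Bit \<open>o\<close> of \<open>record_mask B a l\<close> is set iff \<open>a\<close> attains its minimum over \<open>l, \<dots>, p\<close> at \<open>p\<close>,
  where \<open>p\<close> is the position with offset \<open>o\<close> in the block of \<open>l\<close>. The last such \<open>p\<close> up to \<open>r\<close> is
  then a minimum over \<open>l, \<dots>, r\<close>.\<close>

definition record_mask :: "nat \<Rightarrow> (nat \<Rightarrow> real) \<Rightarrow> nat \<Rightarrow> nat" where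
  "record_mask B a l = horner_sum of_bool 2
     (map (\<lambda>i. l mod B \<le> i \<and> (\<forall>q\<in>{l..l div B * B + i}. a (l div B * B + i) \<le> a q)) [0..<B])"

lemma record_mask_less: "record_mask B a l < 2 ^ B"
  unfolding record_mask_def by (rule less_le_trans[OF horner_sum_of_bool_2_less]) simp

lemma bit_record_mask:
  "bit (record_mask B a l) i \<longleftrightarrow>
     i < B \<and> l mod B \<le> i \<and> (\<forall>q\<in>{l..l div B * B + i}. a (l div B * B + i) \<le> a q)"
  by (auto simp: record_mask_def bit_horner_sum_bit_iff)

text \<open>The reduction modulo \<open>2 ^ Suc (r mod B)\<close> keeps the offsets up to and
  including that of \<open>r\<close>. Any position of the minimum is marked, so the highest
  remaining bit exists and lies at or after it; being marked, it attains the minimum as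
  well.\<close>

lemma record_mask_Min:
  assumes "l \<le> r" "l div B = r div B" "0 < B"
  shows "a (floor_log (record_mask B a l mod 2 ^ Suc (r mod B)) + l div B * B) = Min (a ` {l..r})"
    and "floor_log (record_mask B a l mod 2 ^ Suc (r mod B)) + l div B * B \<le> r"
proof -
  define base where "base = l div B * B"
  define m where "m = record_mask B a l mod 2 ^ Suc (r mod B)"
  have l: "l = base + l mod B" and r: "r = base + r mod B" and "r mod B < B"
    using assms div_mult_mod_eq[of l B] div_mult_mod_eq[of r B] by (simp_all add: base_def)
  have bit_m: "bit m i \<longleftrightarrow> i \<le> r mod B \<and> l mod B \<le> i \<and> (\<forall>q\<in>{l..base + i}. a (base + i) \<le> a q)" for i
    unfolding m_def take_bit_eq_mod[symmetric] bit_take_bit_iff bit_record_mask base_def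
    using \<open>r mod B < B\<close> by auto
  obtain q where q: "q \<in> {l..r}" "a q = Min (a ` {l..r})"
    using Min_in[of "a ` {l..r}"] assms(1) by fastforce
  have q_min: "a q \<le> a x" if "x \<in> {l..r}" for x
    using that q(2) by simp
  have "l \<le> q" "q \<le> r" using q(1) by auto
  then have q_eq: "q = base + (q - base)" using l by linarith
  have bit_q: "bit m (q - base)"
    unfolding bit_m
  proof (intro conjI)
    show "q - base \<le> r mod B" "l mod B \<le> q - base"
      using \<open>l \<le> q\<close> \<open>q \<le> r\<close> l r by linarith+
    show "\<forall>x\<in>{l..base + (q - base)}. a (base + (q - base)) \<le> a x"
      unfolding q_eq[symmetric] using q_min \<open>q \<le> r\<close> by auto
  qed
  then have "0 < m"
    by (cases "m = 0") auto
  define p where "p = base + floor_log m"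
  have p: "floor_log m \<le> r mod B" "l mod B \<le> floor_log m" "\<forall>x\<in>{l..p}. a p \<le> a x"
    using bit_floor_log[OF \<open>0 < m\<close>] unfolding bit_m p_def by auto
  have "q \<le> p"
    using bit_imp_le_floor_log[OF bit_q] q_eq by (simp add: p_def)
  then have "a p \<le> a q"
    using p(3) \<open>l \<le> q\<close> by auto
  moreover have p_in: "p \<in> {l..r}"
    using p(1,2) l r by (simp add: p_def)
  ultimately have a_p: "a p = Min (a ` {l..r})"
    using q_min[of p] unfolding q(2)[symmetric] by (intro antisym)
  have p_eq: "floor_log (record_mask B a l mod 2 ^ Suc (r mod B)) + l div B * B = p"
    by (simp add: p_def m_def base_def)
  show "a (floor_log (record_mask B a l mod 2 ^ Suc (r mod B)) + l div B * B) = Min (a ` {l..r})"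
    "floor_log (record_mask B a l mod 2 ^ Suc (r mod B)) + l div B * B \<le> r"
    using a_p p_in unfolding p_eq by simp_all
qed

text \<open>The last block may reach past the vertex positions. Its value is harmless, since
  suffixes are used only for blocks followed by another block of the range.\<close>

definition block_suffix_min :: "nat \<Rightarrow> (nat \<Rightarrow> real) \<Rightarrow> nat \<Rightarrow> real" where
  "block_suffix_min B a x = Min (a ` {x..<Suc (x div B) * B})"

definition block_prefix_min :: "nat \<Rightarrow> (nat \<Rightarrow> real) \<Rightarrow> nat \<Rightarrow> real" where
  "block_prefix_min B a x = Min (a ` {x div B * B..x})"

text \<open>Since only levels below \<open>B\<close> are needed, the entry for the \<open>2 ^ k\<close> blocks starting with
  block \<open>i\<close> can be kept at position \<open>i * B + k\<close>, inside block \<open>i\<close>.\<close>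

definition sparse_min :: "nat \<Rightarrow> (nat \<Rightarrow> real) \<Rightarrow> nat \<Rightarrow> real" where
  "sparse_min B a x = Min (a ` {x div B * B..<(x div B + 2 ^ (x mod B)) * B})"

lemma Min_split_adjacent_blocks:
  assumes "0 < B" "r div B = Suc (l div B)"
  shows "min (block_suffix_min B a l) (block_prefix_min B a r) = Min (a ` {l..r})"
proof -
  have l: "l < Suc (l div B) * B"
    using assms(1) dividend_less_div_times[of B l] by simp
  have r: "r div B * B \<le> r"
    by simp
  have "{l..r} = {l..<Suc (l div B) * B} \<union> {r div B * B..r}"
    using l r assms(2) by auto
  then show ?thesis
    unfolding block_suffix_min_def block_prefix_min_def
    using l r by (subst Min_image_Un[symmetric]) auto
qed

text \<open>Two runs of \<open>2 ^ floor_log len\<close> blocks, one from each side, cover the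
  blocks in between; their overlap does not affect a minimum. The bound on
  \<open>floor_log len\<close> makes the sparse index decode to the intended block and
  level.\<close>

lemma Min_split_blocks:
  assumes "0 < B" "Suc (l div B) < r div B" "len = r div B - Suc (l div B)" "floor_log len < B"
  shows "min (min (min (block_suffix_min B a l) (block_prefix_min B a r))
      (sparse_min B a (Suc (l div B) * B + floor_log len)))
      (sparse_min B a ((r div B - 2 ^ floor_log len) * B + floor_log len)) = Min (a ` {l..r})"
proof -
  define i j k where "i = Suc (l div B)" and "j = r div B" and "k = floor_log len"
  have ij: "i < j" "len = j - i" "k < B"
    using assms by (auto simp: i_def j_def k_def)
  have k: "2 ^ k \<le> len" "len < 2 * 2 ^ k"
    unfolding k_def using floor_log_exp2_le[of len] floor_log_exp2_gt[of len] ij by auto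
  have l: "l < i * B"
    using assms(1) dividend_less_div_times[of B l] by (simp add: i_def)
  have r: "j * B \<le> r"
    by (simp add: j_def)
  have s1: "sparse_min B a (i * B + k) = Min (a ` {i * B..<(i + 2 ^ k) * B})"
    using ij by (simp add: sparse_min_def)
  have s2: "sparse_min B a ((j - 2 ^ k) * B + k) = Min (a ` {(j - 2 ^ k) * B..<j * B})"
    using ij k by (simp add: sparse_min_def)
  have le: "(i + 2 ^ k) * B \<le> j * B" "i * B \<le> (j - 2 ^ k) * B" "(j - 2 ^ k) * B \<le> (i + 2 ^ k) * B"
    using k ij by (intro mult_right_mono; simp)+
  have lt: "i * B < (i + 2 ^ k) * B" "(j - 2 ^ k) * B < j * B"
    using assms(1) k ij by auto
  have split: "Min (a ` {l..r}) = min (min (min (Min (a ` {l..<x})) (Min (a ` {y..r})))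
      (Min (a ` {x..<x'}))) (Min (a ` {y'..<y}))"
    if "l < x" "x \<le> y'" "y' \<le> x'" "x' \<le> y" "y \<le> r" "x < x'" "y' < y" for x x' y y'
  proof -
    have Un: "Min (a ` (A \<union> B' \<union> C \<union> D)) = min (min (min (Min (a ` A)) (Min (a ` B'))) (Min (a ` C))) (Min (a ` D))"
      if "finite A" "A \<noteq> {}" "finite B'" "B' \<noteq> {}" "finite C" "C \<noteq> {}" "finite D" "D \<noteq> {}" for A B' C D
    proof -
      have "Min (a ` (A \<union> B' \<union> C \<union> D)) = min (Min (a ` (A \<union> B' \<union> C))) (Min (a ` D))"
        "Min (a ` (A \<union> B' \<union> C)) = min (Min (a ` (A \<union> B'))) (Min (a ` C))"
        "Min (a ` (A \<union> B')) = min (Min (a ` A)) (Min (a ` B'))"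
        by (intro Min_image_Un; use that in blast)+
      then show ?thesis by (simp only:)
    qed
    have "{l..r} = {l..<x} \<union> {y..r} \<union> {x..<x'} \<union> {y'..<y}"
      using that by auto
    also have "Min (a ` \<dots>) = min (min (min (Min (a ` {l..<x})) (Min (a ` {y..r})))
      (Min (a ` {x..<x'}))) (Min (a ` {y'..<y}))"
      using that by (intro Un) auto
    finally show ?thesis .
  qed
  have "Min (a ` {l..r}) = min (min (min (Min (a ` {l..<i * B})) (Min (a ` {j * B..r})))
      (Min (a ` {i * B..<(i + 2 ^ k) * B}))) (Min (a ` {(j - 2 ^ k) * B..<j * B}))"
    using l r le lt by (intro split)
  then show ?thesis
    unfolding i_def[symmetric] j_def[symmetric] k_def[symmetric] s1 s2
      block_suffix_min_def block_prefix_min_def by (rule sym)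
qed

section \<open>The query program\<close>

declare run.simps [simp del] word_op_sem.simps [simp del]

lemma run_halt: "length P \<le> pc S \<Longrightarrow> run b P W R T S = Some (rreg S 0)"
  by (subst run.simps) simp

lemma run_step:
  assumes "pc S < length P" "0 < T"
  shows "run b P W R T S = (case exec_instr b W R (P ! pc S) S of
    None \<Rightarrow> None | Some S' \<Rightarrow> run b P W R (T - 1) S')"
  using assms by (subst run.simps) (cases T; simp split: option.split)

text \<open>Segments of the program are evaluated with a fixed numeral as step budget and then
  lifted to any larger one.\<close>

lemma run_mono: "run b P W R T S = Some x \<Longrightarrow> T \<le> T' \<Longrightarrow> run b P W R T' S = Some x"
proof (induction T arbitrary: S T')
  case 0
  then show ?case
    by (cases "length P \<le> pc S") (simp_all add: run_halt run.simps[of _ _ _ _ 0])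
next
  case (Suc T)
  show ?case
  proof (cases "length P \<le> pc S")
    case True
    then show ?thesis using Suc.prems by (simp add: run_halt)
  next
    case False
    then show ?thesis
      using Suc.prems Suc.IH[of _ "T' - 1"]
      by (auto simp: run_step not_le split: option.splits)
  qed
qed

lemma config_simps:
  "pc (set_wreg i x S) = Suc (pc S)" "wreg (set_wreg i x S) = (wreg S)(i := x)"
  "rreg (set_wreg i x S) = rreg S"
  "pc (set_rreg i y S) = Suc (pc S)" "wreg (set_rreg i y S) = wreg S"
  "rreg (set_rreg i y S) = (rreg S)(i := y)"
  "pc (jump_if c l S) = (if c then l else Suc (pc S))" "wreg (jump_if c l S) = wreg S"
  "rreg (jump_if c l S) = rreg S"
  by (simp_all add: set_wreg_def set_rreg_def jump_if_def)

text \<open>Integer registers: 0 and 1 hold the ends of the range, 2, 3, 9, 10 the constants 4, 1,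
  2, 3, register 4 the block length, 5 and 6 block numbers, 7 and 8 scratch values. Real register 1
  holds the running minimum. Real register 5 is never written and stays zero, so
  \<open>RAdd 1 2 5\<close> is a copy.\<close>

definition vitality_program :: "instr list" where
  "vitality_program =
    [WConst 2 4,
     WConst 3 1,
     WConst 9 2,
     WConst 10 3,
     WOp Times 0 0 2,
     WLoad 0 0,
     WOp Times 1 1 2,
     WLoad 1 1,
     JumpIfWLess 0 1 11,
     RSub 0 0 0,
     Jump 66,
     \<comment> \<open>11: compare the blocks of the two ends of the range\<close>
     WOp Minus 1 1 3,
     WLoad 4 10,
     WOp Div 5 0 4,
     WOp Div 6 1 4,
     JumpIfWLess 5 6 31,
     \<comment> \<open>16: range inside a single block\<close>
     WOp Times 7 0 2,
     WOp Plus 7 7 3,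
     WLoad 7 7,
     WOp Mod 8 1 4,
     WOp Plus 8 8 3,
     WOp Shl 8 3 8,
     WOp Mod 7 7 8,
     WOp Times 7 7 2,
     WOp Plus 7 7 9,
     WLoad 7 7,
     WOp Times 8 5 4,
     WOp Plus 7 7 8,
     WOp Times 7 7 2,
     RLoad 1 7,
     Jump 62,
     \<comment> \<open>31: two different blocks\<close>
     WOp Times 7 0 2,
     WOp Plus 7 7 3,
     RLoad 1 7,
     WOp Times 7 1 2,
     WOp Plus 7 7 9,
     RLoad 2 7,
     JumpIfRLess 1 2 39,
     RAdd 1 2 5,
     WOp Plus 5 5 3,
     JumpIfWLess 5 6 42,
     Jump 62,
     \<comment> \<open>42: blocks in between\<close>
     WOp Minus 7 6 5,
     WOp Times 7 7 2,
     WOp Plus 7 7 9,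
     WLoad 7 7,
     WOp Times 8 5 4,
     WOp Plus 8 8 7,
     WOp Times 8 8 2,
     WOp Plus 8 8 10,
     RLoad 2 8,
     JumpIfRLess 1 2 53,
     RAdd 1 2 5,
     WOp Shl 8 3 7,
     WOp Minus 8 6 8,
     WOp Times 8 8 4,
     WOp Plus 8 8 7,
     WOp Times 8 8 2,
     WOp Plus 8 8 10,
     RLoad 2 8,
     JumpIfRLess 1 2 62,
     RAdd 1 2 5,
     \<comment> \<open>62: positive part of the capacity minus the range minimum\<close>
     JumpIfRLess 1 0 65,
     RSub 0 0 0,
     Jump 66,
     RSub 0 0 1]"

lemma length_vitality_program: "length vitality_program = 66"
  by (simp add: vitality_program_def)

lemmas program_fetch =
  arg_cong[where f = "\<lambda>P. P ! 0", OF vitality_program_def]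
  arg_cong[where f = "\<lambda>P. P ! Suc 0", OF vitality_program_def]
  arg_cong[where f = "\<lambda>P. P ! numeral k" for k, OF vitality_program_def]

text \<open>The window from \<open>lo\<close> to \<open>hi\<close> confines symbolic execution to
  one segment; beyond it the rule no longer fires and the lemma on the next segment applies.\<close>

lemma program_step:
  assumes "lo \<le> pc S" "pc S < hi" "hi \<le> 66" "0 < T"
  shows "run b vitality_program W R T S = (case exec_instr b W R (vitality_program ! pc S) S of
    None \<Rightarrow> None | Some S' \<Rightarrow> run b vitality_program W R (T - 1) S')"
  using assms by (intro run_step) (simp_all add: length_vitality_program)

definition cell :: "nat \<Rightarrow> nat \<Rightarrow> nat" where
  "cell j i = i * 4 + j"

section \<open>Lookup tables and correctness of the query\<close>

locale vitality_tables =
  fixes b n :: nat and pos :: "nat \<Rightarrow> nat" and a :: "nat \<Rightarrow> real"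
  assumes two_le_n: "2 \<le> n" and word_size: "8 * n \<le> 2 ^ b"
    and pos_less: "i < n \<Longrightarrow> pos i < n"
begin

text \<open>Small enough that record masks stay below \<open>n\<close>, so they fit a word and index
  the \<open>floor_log\<close> column; large enough for all sparse levels, by
  \<open>floor_log_inner_less\<close>.\<close>

abbreviation "B \<equiv> floor_log n"

text \<open>The machine has no logarithm instruction, hence a column for \<open>floor_log\<close>.
  Of the copies of \<open>B\<close> the program reads only the one at address 3.\<close>

definition word_table :: "nat list" where
  "word_table = map (\<lambda>k. if k mod 4 = 0 then pos (k div 4)
      else if k mod 4 = 1 then record_mask B a (k div 4)
      else if k mod 4 = 2 then floor_log (k div 4) else B) [0..<4 * n]"

definition real_table :: "real list" where
  "real_table = map (\<lambda>k. if k mod 4 = 0 then a (k div 4)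
      else if k mod 4 = 1 then block_suffix_min B a (k div 4)
      else if k mod 4 = 2 then block_prefix_min B a (k div 4)
      else sparse_min B a (k div 4)) [0..<4 * n]"

lemma B_pos: "0 < B"
  using two_le_n floor_log_le_iff[of 2 n] by (simp add: floor_log.simps)

lemma power_B_le: "2 ^ B \<le> n"
  using two_le_n by (intro floor_log_exp2_le) simp

lemma n_less_power_B: "n < 2 * 2 ^ B"
  by (rule floor_log_exp2_gt)

lemma B_less: "B < n"
  using power_B_le less_exp[of B] by linarith

lemma length_tables: "length word_table = 4 * n" "length real_table = 4 * n"
  by (simp_all add: word_table_def real_table_def)

lemma cell_less: "i < n \<Longrightarrow> j < 4 \<Longrightarrow> cell j i < 4 * n"
  by (simp add: cell_def)

lemma cell_div_mod: "j < 4 \<Longrightarrow> cell j i mod 4 = j" "j < 4 \<Longrightarrow> cell j i div 4 = i"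
  by (simp_all add: cell_def)

lemma table_nth:
  assumes "i < n"
  shows "word_table ! cell 0 i = pos i" "word_table ! cell (Suc 0) i = record_mask B a i"
    "word_table ! cell 2 i = floor_log i" "word_table ! cell 3 i = B"
    "real_table ! cell 0 i = a i" "real_table ! cell (Suc 0) i = block_suffix_min B a i"
    "real_table ! cell 2 i = block_prefix_min B a i" "real_table ! cell 3 i = sparse_min B a i"
  using cell_less[OF assms, of 0] cell_less[OF assms, of "Suc 0"]
    cell_less[OF assms, of 2] cell_less[OF assms, of 3]
  by (simp_all add: word_table_def real_table_def cell_div_mod)

lemma word_table_less: "x \<in> set word_table \<Longrightarrow> x < 2 ^ b"
proof -
  assume "x \<in> set word_table"
  then obtain k where "k < 4 * n" "x = word_table ! k"
    by (metis in_set_conv_nth length_tables(1))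
  moreover have "k = cell (k mod 4) (k div 4)"
    by (simp add: cell_def)
  moreover have "k mod 4 \<in> {0, Suc 0, 2, 3}"
    using mod_less_divisor[of 4 k] by (auto simp del: mod_less_divisor)
  ultimately obtain i where i: "i < n" and
      x: "x \<in> {pos i, record_mask B a i, floor_log i, B}"
    using table_nth[of "k div 4"] by (metis insert_iff less_mult_imp_div_less mult.commute singletonD)
  have "floor_log i \<le> i" for i
    using floor_log_exp2_le[of i] less_exp[of "floor_log i"] by (cases "i = 0"; linarith?) simp
  then have "x < n"
    using x i pos_less[of i] record_mask_less[of B a i] power_B_le B_less
    by (auto intro: le_less_trans)
  then show ?thesis
    using word_size by linarith
qed

lemma small: "x < 8 * n \<Longrightarrow> x < 2 ^ b"
  using word_size by linarith

lemma word_op_eqs: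
  "x + y < 8 * n \<Longrightarrow> word_op_sem b Plus x y = x + y"
  "x * y < 8 * n \<Longrightarrow> word_op_sem b Times x y = x * y"
  "y \<le> x \<Longrightarrow> x < 8 * n \<Longrightarrow> word_op_sem b Minus x y = x - y"
  "x < 8 * n \<Longrightarrow> word_op_sem b Div x y = x div y"
  "x < 8 * n \<Longrightarrow> word_op_sem b Mod x y = x mod y"
  "x * 2 ^ y < 8 * n \<Longrightarrow> word_op_sem b Shl x y = x * 2 ^ y"
proof -
  show "word_op_sem b Minus x y = x - y" if "y \<le> x" "x < 8 * n"
  proof -
    have "x + 2 ^ b - y = (x - y) + 2 ^ b" using that(1) by simp
    then show ?thesis
      using small[of "x - y"] that
      by (simp only: word_op_sem.simps take_bit_nat_def mod_add_self2) simp
  qed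
  show "word_op_sem b Div x y = x div y" if "x < 8 * n"
    using small[of "x div y"] that
    by (simp add: word_op_sem.simps take_bit_nat_eq_self order.strict_trans1[OF div_le_dividend])
  show "word_op_sem b Mod x y = x mod y" if "x < 8 * n"
    using small[of "x mod y"] that
    by (simp add: word_op_sem.simps take_bit_nat_eq_self order.strict_trans1[OF mod_less_eq_dividend])
qed (simp_all add: word_op_sem.simps take_bit_nat_eq_self small push_bit_nat_def)

lemma address_eqs:
  assumes "i < n"
  shows "word_op_sem b Times i 4 = cell 0 i"
    "word_op_sem b Plus (cell 0 i) (Suc 0) = cell (Suc 0) i"
    "word_op_sem b Plus (cell 0 i) 2 = cell 2 i"
    "word_op_sem b Plus (cell 0 i) 3 = cell 3 i"
  using assms by (simp_all add: word_op_eqs cell_def)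

lemma load_in_bounds:
  "i < n \<Longrightarrow> cell 0 i < length word_table" "i < n \<Longrightarrow> cell (Suc 0) i < length word_table"
  "i < n \<Longrightarrow> cell 2 i < length word_table" "i < n \<Longrightarrow> cell 3 i < length word_table"
  "i < n \<Longrightarrow> cell 0 i < length real_table" "i < n \<Longrightarrow> cell (Suc 0) i < length real_table"
  "i < n \<Longrightarrow> cell 2 i < length real_table" "i < n \<Longrightarrow> cell 3 i < length real_table"
  by (simp_all add: length_tables cell_less)


lemmas exec_simps = config_simps program_fetch table_nth load_in_bounds

lemma run_final:
  assumes "pc S = 62" "6 \<le> T"
  shows "run b vitality_program W R T S = Some (max 0 (rreg S 0 - rreg S 1))"
proof (rule run_mono[OF _ assms(2)])
  show "run b vitality_program W R 6 S = Some (max 0 (rreg S 0 - rreg S 1))"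
    using assms(1)
    by (cases "rreg S 1 < rreg S 0")
      (simp_all add: program_step[where lo = 62 and hi = 66] run_halt length_vitality_program exec_simps)
qed

text \<open>If \<open>B\<close> is at least 2, then \<open>2 * j \<le> j * B < 2 * 2 ^ B\<close>. If
  \<open>B = 1\<close>, then \<open>n < 4\<close> and, as \<open>i\<close> is positive,
  \<open>j - i\<close> is 1.\<close>

lemma floor_log_inner_less:
  assumes ij: "0 < i" "i < j" "j * B < n"
  shows "floor_log (j - i) < B"
proof -
  define k where "k = floor_log (j - i)"
  have k: "2 ^ k \<le> j - i"
    unfolding k_def using ij by (intro floor_log_exp2_le) simp
  have "k < B"
  proof (cases "B = 1")
    case True
    then have "j - i < 2" using ij n_less_power_B by simp
    then have "(2::nat) ^ k < 2 ^ 1" using k by simp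
    then have "k < 1" by (rule power_less_imp_less_exp[rotated]) simp
    then show ?thesis using True by simp
  next
    case False
    then have "j * 2 \<le> j * B" using B_pos by (intro mult_left_mono) auto
    then have "(2::nat) ^ k < 2 ^ B" using ij k n_less_power_B by linarith
    then show ?thesis by (rule power_less_imp_less_exp[rotated]) simp
  qed
  then show ?thesis by (simp add: k_def)
qed

lemma run_inner_blocks:
  assumes S: "pc S = 42" "wreg S 2 = 4" "wreg S 3 = Suc 0" "wreg S 9 = 2" "wreg S 10 = 3"
      "wreg S 4 = B" "wreg S 5 = i" "wreg S 6 = j" "rreg S 5 = 0"
    and ij: "0 < i" "i < j" "j * B < n" and "30 \<le> T"
  defines "k \<equiv> floor_log (j - i)"
  shows "run b vitality_program word_table real_table T S = Some (max 0 (rreg S 0 -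
      min (min (rreg S 1) (sparse_min B a (i * B + k))) (sparse_min B a ((j - 2 ^ k) * B + k))))"
proof -
  have k: "2 ^ k \<le> j - i"
    unfolding k_def using ij by (intro floor_log_exp2_le) simp
  have "k < B"
    unfolding k_def using ij by (rule floor_log_inner_less)
  have "j \<le> j * B" using B_pos by simp
  moreover have "(i + 1) * B \<le> j * B" "(j - 2 ^ k + 1) * B \<le> j * B"
    using k ij by (intro mult_right_mono; use zero_less_power[of "2::nat" k] in linarith)+
  moreover have "i * B + k < (i + 1) * B" "(j - 2 ^ k) * B + k < (j - 2 ^ k + 1) * B"
    using \<open>k < B\<close> by simp_all
  ultimately
  have bounds: "j < n" "j - i < n" "i * B + k < n" "(j - 2 ^ k) * B + k < n" "i * B < n" "(j - 2 ^ k) * B < n"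
     "2 ^ k < n"
    using ij k by linarith+
  have ops: "word_op_sem b Minus j i = j - i" "word_op_sem b Times i B = i * B"
    "word_op_sem b Plus (i * B) k = i * B + k" "word_op_sem b Shl (Suc 0) k = 2 ^ k"
    "word_op_sem b Minus j (2 ^ k) = j - 2 ^ k" "word_op_sem b Times (j - 2 ^ k) B = (j - 2 ^ k) * B"
    "word_op_sem b Plus ((j - 2 ^ k) * B) k = (j - 2 ^ k) * B + k"
    using bounds ij k by (auto intro!: word_op_eqs[THEN trans])
  let ?s = "sparse_min B a (i * B + k)" and ?s' = "sparse_min B a ((j - 2 ^ k) * B + k)"
  let ?m = "min (rreg S 1) ?s"
  have "run b vitality_program word_table real_table 30 S = Some (max 0 (rreg S 0 - min ?m ?s'))"
    by (cases "rreg S 1 < ?s"; cases "?m < ?s'")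
      (simp_all add: program_step[where lo = 42 and hi = 62] run_final S ops address_eqs bounds exec_simps
        k_def[symmetric])
  then show "run b vitality_program word_table real_table T S = Some (max 0 (rreg S 0 - min ?m ?s'))"
    using \<open>30 \<le> T\<close> by (rule run_mono)
qed


lemma run_same_block:
  assumes S: "pc S = 16" "wreg S 2 = 4" "wreg S 3 = Suc 0" "wreg S 9 = 2"
      "wreg S 4 = B" "wreg S 5 = l div B" "wreg S 0 = l" "wreg S (Suc 0) = r"
    and lr: "l \<le> r" "r < n" "l div B = r div B" and "30 \<le> T"
  shows "run b vitality_program word_table real_table T S =
    Some (max 0 (rreg S 0 - Min (a ` {l..r})))"
proof -
  define o' m where "o' = Suc (r mod B)" and "m = record_mask B a l mod 2 ^ o'"
  define p where "p = floor_log m + l div B * B"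
  have p: "a p = Min (a ` {l..r})" "p \<le> r"
    unfolding p_def m_def o'_def using record_mask_Min[OF lr(1,3) B_pos] by blast+
  \<comment> \<open>This keeps \<open>2 ^ o'\<close> at most \<open>n\<close>, so the shift that
    builds the modulus does not wrap around.\<close>
  have "o' \<le> B"
    using B_pos by (simp add: o'_def Suc_le_eq)
  then have "(2::nat) ^ o' \<le> 2 ^ B"
    by (intro power_increasing) auto
  then have bounds: "2 ^ o' \<le> n" "o' < n" "record_mask B a l < n" "m < n" "p < n" "l < n" "l div B * B \<le> l"
    using power_B_le B_less \<open>o' \<le> B\<close> record_mask_less[of B a l] p(2) lr
      mod_less_eq_dividend[of "record_mask B a l" "2 ^ o'"] div_times_less_eq_dividend[of l B]
    unfolding m_def by linarith+
  have ops: "word_op_sem b Mod r B = r mod B" "word_op_sem b Plus (r mod B) (Suc 0) = o'"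
    "word_op_sem b Shl (Suc 0) o' = 2 ^ o'"
    "word_op_sem b Times (l div B) B = l div B * B"
    using bounds lr by (simp_all add: word_op_eqs o'_def)
  have ops': "word_op_sem b Mod (record_mask B a l) (2 ^ o') = m"
    "word_op_sem b Plus (floor_log m) (l div B * B) = p"
    using bounds word_op_eqs(5)[of "record_mask B a l" "2 ^ o'"]
      word_op_eqs(1)[of "floor_log m" "l div B * B", folded p_def]
    by (simp_all add: m_def)
  have "run b vitality_program word_table real_table 30 S = Some (max 0 (rreg S 0 - a p))"
    using bounds
    by (simp add: program_step[where lo = 16 and hi = 31] run_final S ops ops' lr(3)[symmetric] address_eqs exec_simps)
  then show ?thesis
    using \<open>30 \<le> T\<close> unfolding p(1) by (rule run_mono)
qed

lemma run_different_blocks: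
  assumes S: "pc S = 31" "wreg S 2 = 4" "wreg S 3 = Suc 0" "wreg S 9 = 2" "wreg S 10 = 3"
      "wreg S 4 = B" "wreg S 5 = l div B" "wreg S 6 = r div B" "wreg S 0 = l" "wreg S (Suc 0) = r"
      "rreg S 5 = 0"
    and lr: "r < n" "l div B < r div B" and "50 \<le> T"
  shows "run b vitality_program word_table real_table T S =
    Some (max 0 (rreg S 0 - Min (a ` {l..r})))"
proof -
  let ?i = "Suc (l div B)" and ?j = "r div B"
  let ?s = "block_suffix_min B a l" and ?p = "block_prefix_min B a r"
  have bounds: "l < n" "?i \<le> ?j" "?j * B \<le> r" "?j \<le> r"
    using lr div_le_mono[of r l B] div_times_less_eq_dividend[of r B] div_le_dividend[of r B]
    by linarith+
  have ops: "word_op_sem b Plus (l div B) (Suc 0) = ?i"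
    by (subst word_op_eqs(1); use bounds lr in linarith)
  have "run b vitality_program word_table real_table 50 S = Some (max 0 (rreg S 0 - Min (a ` {l..r})))"
  proof (cases "?i = ?j")
    case True
    have "Min (a ` {l..r}) = min ?s ?p"
      using True B_pos by (intro Min_split_adjacent_blocks[symmetric]) auto
    then show ?thesis
      using bounds lr True
      by (cases "?s < ?p")
        (simp_all add: program_step[where lo = 31 and hi = 42] run_final S ops address_eqs exec_simps)
  next
    case False
    define k where "k = floor_log (?j - ?i)"
    note inner = run_inner_blocks[where i = ?i and j = ?j, folded k_def]
    have ij: "?i < ?j" "?j * B < n"
      using bounds lr False by linarith+
    have "k < B"
      unfolding k_def using ij by (intro floor_log_inner_less) auto
    define y where "y = Min (a ` {l..r})"
    have y_eq: "y = min (min (min ?s ?p) (sparse_min B a (?i * B + k))) (sparse_min B a ((?j - 2 ^ k) * B + k))"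
      unfolding y_def k_def using B_pos ij \<open>k < B\<close>
      by (intro Min_split_blocks[symmetric]) (auto simp: k_def)
    \<comment> \<open>With the content of real register 1 as a premise, both outcomes of the
      preceding comparison lead to the same continuation.\<close>
    have inner': "run b vitality_program word_table real_table T S =
        Some (max 0 (rreg S 0 - y))"
      if "pc S = 42" "wreg S 2 = 4" "wreg S 3 = Suc 0" "wreg S 9 = 2" "wreg S 10 = 3"
        "wreg S 4 = B" "wreg S 5 = ?i" "wreg S 6 = ?j" "rreg S 5 = 0" "30 \<le> T"
        "rreg S (Suc 0) = min ?s ?p" for S T
      using inner[OF that(1-9) zero_less_Suc ij that(10)]
      unfolding One_nat_def that(11) y_eq[symmetric] .
    show ?thesis
      unfolding y_def[symmetric]
      using bounds lr ij
      by (cases "?s < ?p")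
        (simp_all add: program_step[where lo = 31 and hi = 42] inner' S ops address_eqs exec_simps)
  qed
  then show ?thesis
    using \<open>50 \<le> T\<close> by (rule run_mono)
qed

lemma run_vitality_program:
  assumes "i < n" "j < n"
  shows "run b vitality_program word_table real_table 80 (query i j x) =
    Some (if pos i < pos j then max 0 (x - Min (a ` {pos i..<pos j})) else 0)"
proof -
  have "(2::nat) ^ 2 < 2 ^ b"
    using word_size two_le_n by simp
  then have "2 < b"
    by (rule power_less_imp_less_exp[rotated]) simp
  then have b: "0 < b" "2 \<le> b" by simp_all
  have const_eqs: "take_bit b 4 = (4::nat)" "take_bit b (Suc 0) = Suc 0" "take_bit b 2 = (2::nat)"
    "take_bit b 3 = (3::nat)"
    using two_le_n by (simp_all only: take_bit_nat_eq_self small)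
  have pos: "pos i < n" "pos j < n" using assms by (simp_all add: pos_less)
  have query: "pc (query i j x) = 0" "wreg (query i j x) = (\<lambda>_. 0)(0 := i, 1 := j)"
    "rreg (query i j x) = (\<lambda>_. 0)(0 := x)"
    by (simp_all add: query_def)
  have load_B: "3 < length word_table" "word_table ! 3 = B"
    using two_le_n load_in_bounds(4)[of 0] table_nth(4)[of 0] by (simp_all add: cell_def)
  show ?thesis
  proof (cases "pos i < pos j")
    case False
    then show ?thesis
      using assms
      by (simp add: program_step[where lo = 0 and hi = 66] run_halt length_vitality_program query
        b const_eqs numeral_2_eq_2[symmetric] address_eqs exec_simps)
  next
    case True
    \<comment> \<open>The program decrements the right end, turning the half-open range of gaps into
      a closed one.\<close>
    define r where "r = pos j - 1"
    have r: "pos i \<le> r" "r < n" "{pos i..<pos j} = {pos i..r}"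
      using True pos by (auto simp: r_def)
    have ops: "word_op_sem b Minus (pos j) (Suc 0) = r"
      "word_op_sem b Div r B = r div B" "word_op_sem b Div (pos i) B = pos i div B"
      using pos True r by (simp_all add: word_op_eqs r_def)
    show ?thesis
    proof (cases "pos i div B = r div B")
      case same: True
      then show ?thesis
        using assms True r
        by (simp add: program_step[where lo = 0 and hi = 16] run_same_block[where l = "pos i" and r = r] query
          b const_eqs numeral_2_eq_2[symmetric] address_eqs ops load_B exec_simps)
    next
      case False
      then have "pos i div B < r div B"
        using r div_le_mono[of "pos i" r B] by simp
      then show ?thesis
        using assms True r
        by (simp add: program_step[where lo = 0 and hi = 16] run_different_blocks[where l = "pos i" and r = r] query
          b const_eqs numeral_2_eq_2[symmetric] address_eqs ops load_B exec_simps)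
    qed
  qed
qed

end

theorem theorem4:
  shows "\<exists>(P :: instr list) (T :: nat) (c :: nat).
    \<forall>(G :: ('v, 'e) pre_digraph) (w :: 'e \<Rightarrow> real) (s :: 'v) (t :: 'v) (num :: 'v \<Rightarrow> nat) (b :: nat).
      fin_digraph G \<and> s \<in> verts G \<and> t \<in> verts G \<and> s \<noteq> t \<and>
      (\<forall>e\<in>arcs G. 0 < w e) \<and>
      bij_betw num (verts G) {..<card (verts G)} \<and>
      c * card (verts G) \<le> 2 ^ b \<longrightarrow>
      (\<exists>(W :: nat list) (R :: real list).
        length W + length R \<le> c * card (verts G) \<and>
        (\<forall>x\<in>set W. x < 2 ^ b) \<and>
        (\<forall>e\<in>arcs G.
          run b P W R T (query (num (tail G e)) (num (head G e)) (w e)) = Some (vitality G w s t e)))"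
proof (rule exI[of _ vitality_program], rule exI[of _ 80], rule exI[of _ 8], intro allI impI, elim conjE)
  fix G :: "('v, 'e) pre_digraph" and w :: "'e \<Rightarrow> real" and s t :: 'v and num :: "'v \<Rightarrow> nat" and b :: nat
  assume G: "fin_digraph G" and s: "s \<in> verts G" and t: "t \<in> verts G" and st: "s \<noteq> t"
    and pos: "\<forall>e\<in>arcs G. 0 < w e" and num: "bij_betw num (verts G) {..<card (verts G)}"
    and b: "8 * card (verts G) \<le> 2 ^ b"
  interpret fin_digraph G by (rule G)
  interpret st_network G w s t
    by unfold_locales (use s st pos in auto)
  define n where "n = card (verts G)"
  obtain p a where p: "p ` verts G \<subseteq> {..<n}" and vit: "\<And>e. e \<in> arcs G \<Longrightarrow> vitality G w s t e =
      (if p (tail G e) < (p (head G e) :: nat) then max 0 (w e - Min (a ` {p (tail G e)..<p (head G e)})) else 0)"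
    using exists_vitality_tables unfolding n_def by blast
  \<comment> \<open>Queries pass vertex numbers, so the positions are reindexed along
    \<open>num\<close>.\<close>
  define p' where "p' = p \<circ> inv_into (verts G) num"
  have p'_num: "p' (num v) = p v" if "v \<in> verts G" for v
    using that num by (simp add: p'_def bij_betw_def)
  interpret tables: vitality_tables b n p' a
  proof
    have "card {s, t} \<le> n"
      unfolding n_def using s t by (intro card_mono) auto
    then show "2 \<le> n" using st by simp
    show "8 * n \<le> 2 ^ b" using b by (simp add: n_def)
    show "p' i < n" if "i < n" for i
      using that p num inv_into_into[of i num "verts G"]
      by (auto simp: p'_def n_def bij_betw_def image_subset_iff)
  qed
  show "\<exists>(W :: nat list) (R :: real list).
        length W + length R \<le> 8 * card (verts G) \<and>
        (\<forall>x\<in>set W. x < 2 ^ b) \<and>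
        (\<forall>e\<in>arcs G.
          run b vitality_program W R 80 (query (num (tail G e)) (num (head G e)) (w e)) = Some (vitality G w s t e))"
  proof (intro exI[of _ tables.word_table] exI[of _ tables.real_table] conjI ballI)
    \<comment> \<open>Two tables with four entries per vertex account for the constant 8.\<close>
    show "length tables.word_table + length tables.real_table \<le> 8 * card (verts G)"
      unfolding tables.length_tables by (simp add: n_def)
    show "x < 2 ^ b" if "x \<in> set tables.word_table" for x
      using that by (rule tables.word_table_less)
    show "run b vitality_program tables.word_table tables.real_table 80
        (query (num (tail G e)) (num (head G e)) (w e)) = Some (vitality G w s t e)"
      if e: "e \<in> arcs G" for e
    proof -
      have "num (tail G e) < n" "num (head G e) < n"
        using e num by (auto simp: n_def bij_betw_def)
      then show ?thesis
        using e by (simp add: tables.run_vitality_program vit p'_num)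
    qed
  qed
qed

end
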